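(* Let $L_1$ and $L_2$ be lists (multisets) of positive integers. If each of $L_1$ and $L_2$ has a standard linear realization, then the multiset union $L=L_1\cup L_2$ has a linear realization.
   Context: For a list (multiset) $L$ of positive integers with $|L|$ elements, a linear realization of $L$ is an ordering $[x_0,x_1,\ldots,x_{|L|}]$ of the integers $\{0,1,\ldots,|L|\}$ (i.e., a Hamiltonian path of the complete graph on these vertices) such that the multiset $\{|x_i-x_{i+1}| : 0\leq i\leq |L|-1\}$ equals $L$. A linear realization is standard if $x_0=0$. *)

theory Defs
  imports Complex_Main "HOL-Library.Multiset"
begin

text \<open>The differences are taken in the integers, since subtraction on \<open>nat\<close> truncates.\<close>

definition linear_realization :: "nat multiset \<Rightarrow> nat list \<Rightarrow> bool" where
  "linear_realization L xs \<longleftrightarrow>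
     distinct xs \<and> set xs = {0..size L} \<and>
     {# nat \<bar>int (xs ! i) - int (xs ! (i + 1))\<bar>. i \<in># mset_set {0..<size L} #} = L"

definition standard_linear_realization :: "nat multiset \<Rightarrow> nat list \<Rightarrow> bool" where
  "standard_linear_realization L xs \<longleftrightarrow> linear_realization L xs \<and> xs ! 0 = 0"

end

theory Submission
  imports Defs
begin

text \<open>Reflect the first realization so that it ends at its largest vertex \<open>size L1\<close>, translate the
  second one so that it starts there, and concatenate the two paths at that common vertex.\<close>

text \<open>Recursion on adjacent entries replaces indexing, so that concatenation, reversal and
  mapping can be handled by list induction.\<close>

fun path_diffs :: "nat list \<Rightarrow> nat multiset" where
  "path_diffs (x # y # zs) = add_mset (nat \<bar>int x - int y\<bar>) (path_diffs (y # zs))"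
| "path_diffs _ = {#}"

lemma image_mset_diffs_conv_path_diffs:
  "{# nat \<bar>int (xs ! i) - int (xs ! (i + 1))\<bar>. i \<in># mset_set {0..<length xs - 1} #} = path_diffs xs"
proof (induction xs rule: path_diffs.induct)
  case (1 x y zs)
  have "mset_set {0..<length (x # y # zs) - 1} =
      add_mset 0 (image_mset Suc (mset_set {0..<length (y # zs) - 1}))"
    by (simp add: image_mset_mset_set atLeast0_lessThan_Suc_eq_insert_0)
  then show ?case
    using 1 by (simp add: image_mset.compositionality o_def)
qed simp_all

text \<open>A distinct list with entries \<open>{0..size L}\<close> has length
  \<open>size L + 1\<close>, so the index range of the definition is exactly the range of adjacent
  pairs.\<close>

lemma linear_realization_iff_path_diffs:
  "linear_realization L xs \<longleftrightarrow>
     distinct xs \<and> set xs = {0..size L} \<and> path_diffs xs = L"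
proof -
  have "length xs = Suc (size L)" if "distinct xs" "set xs = {0..size L}"
    using distinct_card[OF that(1)] that(2) by simp
  then show ?thesis
    using image_mset_diffs_conv_path_diffs[of xs] by (auto simp: linear_realization_def)
qed

text \<open>The vertex \<open>x\<close> is kept in both pieces, so cutting there loses no adjacent
  pair.\<close>

lemma path_diffs_append:
  "path_diffs (xs @ x # ys) = path_diffs (xs @ [x]) + path_diffs (x # ys)"
  by (induction xs rule: path_diffs.induct) simp_all

lemma path_diffs_rev: "path_diffs (rev xs) = path_diffs xs"
proof (induction xs rule: path_diffs.induct)
  case (1 x y zs)
  then show ?case
    using path_diffs_append[of "rev zs" y "[x]"] by (simp add: abs_minus_commute)
qed simp_all

text \<open>Distances need to be preserved only on \<open>set xs\<close>: the reflection
  \<open>n - x\<close> truncates for \<open>x\<close> above \<open>n\<close>.\<close>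

lemma path_diffs_map_isometry:
  assumes "\<And>x y. x \<in> set xs \<Longrightarrow> y \<in> set xs \<Longrightarrow> \<bar>int (f x) - int (f y)\<bar> = \<bar>int x - int y\<bar>"
  shows "path_diffs (map f xs) = path_diffs xs"
  using assms by (induction xs rule: path_diffs.induct) simp_all

theorem theorem2p2:
  fixes L1 L2 :: "nat multiset"
  assumes "\<forall>l \<in># L1. 0 < l"
    and "\<forall>l \<in># L2. 0 < l"
    and "\<exists>xs. standard_linear_realization L1 xs"
    and "\<exists>ys. standard_linear_realization L2 ys"
  shows "\<exists>zs. linear_realization (L1 + L2) zs"
proof -
  obtain xs ys where std: "standard_linear_realization L1 xs" "standard_linear_realization L2 ys"
    using assms(3,4) by blast
  have xs: "distinct xs" "set xs = {0..size L1}" "path_diffs xs = L1" "xs ! 0 = 0"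
    and ys: "distinct ys" "set ys = {0..size L2}" "path_diffs ys = L2" "ys ! 0 = 0"
    using std by (simp_all add: standard_linear_realization_def linear_realization_iff_path_diffs)
  obtain us where us: "xs = 0 # us"
    using xs(2,4) by (cases xs) auto
  obtain vs where vs: "ys = 0 # vs"
    using ys(2,4) by (cases ys) auto
  define n where "n = size L1"
  define refl where "refl = map (\<lambda>x. n - x) xs"
  \<comment> \<open>\<open>rev refl\<close> ends at \<open>n - 0 = n\<close>, which is also the
    translate of the head of \<open>ys\<close>; hence only the tail \<open>vs\<close> is
    appended.\<close>
  define zs where "zs = rev refl @ map ((+) n) vs"
  have "set vs = {0..size L2} - {0}"
    using ys(1,2) vs by auto
  also have "\<dots> = {1..size L2}"
    by auto
  finally have set_vs: "set vs = {1..size L2}" .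
  have set_refl: "set refl = {0..n}"
  proof -
    have "(\<lambda>x. n - x) ` {0..n} = {0..n}"
    proof (intro equalityI subsetI)
      fix x assume "x \<in> {0..n}"
      then show "x \<in> (\<lambda>x. n - x) ` {0..n}"
        \<comment> \<open>The reflection is its own inverse on \<open>{0..n}\<close>.\<close>
        by (intro image_eqI[of _ _ "n - x"]) simp_all
    qed auto
    then show ?thesis
      using xs(2) by (simp add: refl_def n_def)
  qed
  have "inj_on (\<lambda>x. n - x) (set xs)"
    using xs(2) by (auto simp: inj_on_def n_def)
  then have "distinct refl"
    using xs(1) by (simp add: refl_def distinct_map)
  then have "distinct zs"
    \<comment> \<open>The two pieces occupy \<open>{0..n}\<close> and
      \<open>{n + 1..n + size L2}\<close>, which are disjoint.\<close>
    using ys(1) vs set_refl set_vs by (auto simp: zs_def distinct_map)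
  moreover have "set zs = {0..size (L1 + L2)}"
    using set_refl set_vs by (auto simp: zs_def n_def image_add_atLeastAtMost)
  moreover have "path_diffs zs = L1 + L2"
  proof -
    \<comment> \<open>Cutting at the common vertex \<open>n\<close> restores it as the head of the
      second piece, which is therefore the translate of all of \<open>ys\<close>.\<close>
    have "path_diffs zs = path_diffs (rev refl) + path_diffs (map ((+) n) ys)"
      using path_diffs_append[of "rev (map (\<lambda>x. n - x) us)" n "map ((+) n) vs"]
      by (simp add: zs_def refl_def us vs)
    also have "path_diffs (rev refl) = L1"
      unfolding path_diffs_rev refl_def
      by (subst path_diffs_map_isometry) (simp_all add: xs(2,3) flip: n_def)
    also have "path_diffs (map ((+) n) ys) = L2"
      by (subst path_diffs_map_isometry) (simp_all add: ys(3))
    finally show ?thesis .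
  qed
  ultimately show ?thesis
    by (auto simp: linear_realization_iff_path_diffs)
qed

end
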